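(* Let $l\ge 1$ and $n>l$ be integers, let $t(X)=s(X)$ be an equation in $Eq(n)$, and let $Y=\mathrm{V}(t(X)=s(X))\subseteq L_l^n$. Then \[ Y=\bigcup_{\sigma\text{ is }Y\text{-irreducible}}Y_\sigma , \] the union being over all $Y$-irreducible ordered partitions $\sigma$ of $X$.
   Context: $L_l=\{a_1,\dots,a_l\}$ with $a_1<a_2<\dots<a_l$ is the linearly ordered semilattice of $l$ elements, with multiplication $a_i\cdot a_j=a_{\min(i,j)}$. A term in the variables $X=\{x_1,\dots,x_n\}$ is a (non-empty) commutative word in the letters $x_i$ (no constants); $\mathrm{Var}(t)$ is the set of variables occurring in $t$. An equation is an equality of terms $t(X)=s(X)$; an inequality $t(X)\le s(X)$ is also regarded as an equation, namely $t(X)s(X)=t(X)$. $Eq(n)$ is the set of equations $t(X)=s(X)$ such that every variable $x_1,\dots,x_n$ occurs in $t$ or in $s$. A point $P\in L_l^n$ is a solution of $t(X)=s(X)$ if $t(P)=s(P)$ in $L_l$. A system is an arbitrary set of equations, and $\mathrm{V}(\mathbf{S})\subseteq L_l^n$ is the set of common solutions of a system $\mathbf{S}$ in $n$ variables. An ordered partition of $X$ is a tuple $\sigma=(X_1,\dots,X_l)$ of $l$ pairwise disjoint non-empty sets with union $X$, with classes linearly ordered by $X_1\le_\sigma\dots\le_\sigma X_l$. Write $x_i=_\sigma x_j$ if $x_i,x_j$ lie in the same class, and $x_i<_\sigma x_j$ if the class of $x_i$ strictly precedes that of $x_j$. For $Y=\mathrm{V}(t(X)=s(X))$, $\sigma$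 is $Y$-irreducible if $X_1$ contains a variable from $\mathrm{Var}(t)$ and a variable from $\mathrm{Var}(s)$ (possibly the same). For a $Y$-irreducible $\sigma$, \[ Y_\sigma=\mathrm{V}(\mathbf S_\sigma),\qquad \mathbf S_\sigma=\{x_i=x_j\mid x_i=_\sigma x_j\}\cup\{x_i\le x_j\mid x_i<_\sigma x_j\}. \] *)

theory Defs
  imports Main "HOL-Library.Multiset" "HOL-Library.FuncSet" "HOL-Library.Disjoint_Sets"
begin

text \<open>
  The element $a_i$ of the chain $L_l$ is represented by its index $i$, and the variable $x_i$
  by its index $i$ as well. A commutative word is a multiset of variables; nonemptiness and the
  restriction to $x_1,\dots,x_n$ are imposed by \<open>terms\<close>.
\<close>

type_synonym sterm = "nat multiset"
type_synonym equation = "sterm \<times> sterm"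

definition chain :: "nat \<Rightarrow> nat set" where
  "chain l = {1..l}"

definition chain_mult :: "nat \<Rightarrow> nat \<Rightarrow> nat" where
  "chain_mult i j = min i j"

definition vars :: "nat \<Rightarrow> nat set" where
  "vars n = {1..n}"

definition terms :: "nat \<Rightarrow> sterm set" where
  "terms n = {t. t \<noteq> {#} \<and> set_mset t \<subseteq> vars n}"

definition Var :: "sterm \<Rightarrow> nat set" where
  "Var t = set_mset t"

definition points :: "nat \<Rightarrow> nat \<Rightarrow> (nat \<Rightarrow> nat) set" where
  "points l n = vars n \<rightarrow>\<^sub>E chain l"

text \<open>
  The value of a term at a point of $L_l^n$ is the product of the values of its letters.
  The fold may start from $a_l$ because $a_l$ is neutral in $L_l$, so that the value of a
  nonempty word does not depend on this starting element.
\<close>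

definition eval_term :: "nat \<Rightarrow> (nat \<Rightarrow> nat) \<Rightarrow> sterm \<Rightarrow> nat" where
  "eval_term l P t = fold_mset chain_mult l (image_mset P t)"

definition solves :: "nat \<Rightarrow> (nat \<Rightarrow> nat) \<Rightarrow> equation \<Rightarrow> bool" where
  "solves l P e \<longleftrightarrow> eval_term l P (fst e) = eval_term l P (snd e)"

definition V :: "nat \<Rightarrow> nat \<Rightarrow> equation set \<Rightarrow> (nat \<Rightarrow> nat) set" where
  "V l n S = {P \<in> points l n. \<forall>e\<in>S. solves l P e}"

text \<open>The inequality $t \le s$ is the equation $ts = t$; the product of words is multiset sum.\<close>

definition le_eqn :: "sterm \<Rightarrow> sterm \<Rightarrow> equation" where
  "le_eqn t s = (t + s, t)"

definition Eq :: "nat \<Rightarrow> equation set" where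
  "Eq n = {(t, s). t \<in> terms n \<and> s \<in> terms n \<and> vars n \<subseteq> Var t \<union> Var s}"

text \<open>
  An ordered partition $(X_1,\dots,X_l)$ is a list of length $l$, so $X_k$ is \<open>\<sigma> ! (k - 1)\<close>.
\<close>

definition ordered_partition :: "nat \<Rightarrow> nat \<Rightarrow> nat set list \<Rightarrow> bool" where
  "ordered_partition l n \<sigma> \<longleftrightarrow>
     length \<sigma> = l \<and>
     (\<forall>k<l. \<sigma> ! k \<noteq> {}) \<and>
     disjoint_family_on (\<lambda>k. \<sigma> ! k) {..<l} \<and>
     (\<Union>k<l. \<sigma> ! k) = vars n"

definition part_eq :: "nat set list \<Rightarrow> nat \<Rightarrow> nat \<Rightarrow> bool" where
  "part_eq \<sigma> i j \<longleftrightarrow> (\<exists>k<length \<sigma>. i \<in> \<sigma> ! k \<and> j \<in> \<sigma> ! k)"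

definition part_less :: "nat set list \<Rightarrow> nat \<Rightarrow> nat \<Rightarrow> bool" where
  "part_less \<sigma> i j \<longleftrightarrow> (\<exists>k m. k < m \<and> m < length \<sigma> \<and> i \<in> \<sigma> ! k \<and> j \<in> \<sigma> ! m)"

text \<open>
  Irreducibility of $\sigma$ with respect to $Y = V(t = s)$ refers to the defining equation
  of $Y$, which is therefore the argument here.
\<close>

definition irreducible_for :: "equation \<Rightarrow> nat set list \<Rightarrow> bool" where
  "irreducible_for e \<sigma> \<longleftrightarrow>
     (\<sigma> ! 0) \<inter> Var (fst e) \<noteq> {} \<and> (\<sigma> ! 0) \<inter> Var (snd e) \<noteq> {}"

definition S_part :: "nat set list \<Rightarrow> equation set" where
  "S_part \<sigma> = {({#i#}, {#j#}) | i j. part_eq \<sigma> i j}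
            \<union> {le_eqn {#i#} {#j#} | i j. part_less \<sigma> i j}"

definition Y_part :: "nat \<Rightarrow> nat \<Rightarrow> nat set list \<Rightarrow> (nat \<Rightarrow> nat) set" where
  "Y_part l n \<sigma> = V l n (S_part \<sigma>)"

end

theory Submission
  imports Defs
begin

text \<open>
  A point solves \<open>t = s\<close> iff its overall minimum is attained both at a variable \<open>i\<close> of \<open>t\<close> and at
  a variable \<open>j\<close> of \<open>s\<close>. Its level sets form an ordered partition with at most \<open>l\<close> classes. As long
  as there are fewer than \<open>l < n\<close> classes, two elements other than \<open>j\<close> share a class by the pigeonhole
  principle, and one of them that is not \<open>i\<close> can be split off. So a refinement with exactly \<open>l\<close>
  classes exists in which \<open>i\<close> and \<open>j\<close> stay together in the first one.
\<close>

section \<open>Terms as minima, and solutions of one equation\<close>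

text \<open>Keeping the starting value \<open>l\<close> of the fold inside the minimum covers the
  empty word, so plain induction on the multiset works.\<close>

lemma eval_term_eq_Min_insert:
  "eval_term l P t = Min (insert l (P ` set_mset t))"
proof (induction t)
  case empty
  then show ?case by (simp add: eval_term_def)
next
  case (add x t)
  interpret comp_fun_commute chain_mult
    by standard (auto simp: chain_mult_def fun_eq_iff)
  have "eval_term l P (add_mset x t) = min (P x) (eval_term l P t)"
    by (simp add: eval_term_def chain_mult_def)
  also have "\<dots> = Min (insert (P x) (insert l (P ` set_mset t)))"
    by (simp add: add.IH)
  finally show ?case by (simp add: insert_commute)
qed

lemma eval_term_eq_Min:
  assumes "t \<noteq> {#}" and "\<And>x. x \<in># t \<Longrightarrow> P x \<le> l"
  shows "eval_term l P t = Min (P ` set_mset t)"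
proof -
  obtain x where "x \<in># t" using assms(1) by blast
  then have "Min (P ` set_mset t) \<le> P x" by simp
  then have "Min (P ` set_mset t) \<le> l" using assms(2)[OF \<open>x \<in># t\<close>] by simp
  then have "min l (Min (P ` set_mset t)) = Min (P ` set_mset t)" by (rule min_absorb2)
  then show ?thesis using assms(1) by (simp add: eval_term_eq_Min_insert)
qed

lemma points_le: "P \<in> points l n \<Longrightarrow> x \<in> vars n \<Longrightarrow> P x \<le> l"
  by (auto simp: points_def chain_def dest: PiE_mem)

text \<open>Both sides evaluate to minima. Every variable occurs in \<open>t\<close> or in
  \<open>s\<close>, so if the two minima agree, their common value is the minimum over all
  variables.\<close>

lemma solves_Eq_iff:
  assumes "(t, s) \<in> Eq n" and "P \<in> points l n"
  shows "solves l P (t, s) \<longleftrightarrow>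
    (\<exists>i\<in>Var t. \<exists>j\<in>Var s. P i = P j \<and> (\<forall>x\<in>vars n. P i \<le> P x))"
proof -
  have ne: "t \<noteq> {#}" "s \<noteq> {#}" and un: "vars n = set_mset t \<union> set_mset s"
    using assms(1) by (auto simp: Eq_def terms_def Var_def)
  have le: "P x \<le> l" if "x \<in> set_mset t \<union> set_mset s" for x
    using points_le[OF assms(2)] that un by blast
  have "solves l P (t, s) \<longleftrightarrow> Min (P ` set_mset t) = Min (P ` set_mset s)"
    using le by (simp add: solves_def eval_term_eq_Min[OF ne(1)] eval_term_eq_Min[OF ne(2)])
  also have "\<dots> \<longleftrightarrow>
      (\<exists>i\<in>Var t. \<exists>j\<in>Var s. P i = P j \<and> (\<forall>x\<in>vars n. P i \<le> P x))"
  proof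
    assume eq: "Min (P ` set_mset t) = Min (P ` set_mset s)"
    obtain i where i: "i \<in> set_mset t" "P i = Min (P ` set_mset t)"
      using Min_in[of "P ` set_mset t"] ne by fastforce
    obtain j where j: "j \<in> set_mset s" "P j = Min (P ` set_mset s)"
      using Min_in[of "P ` set_mset s"] ne by fastforce
    have "P i \<le> P x" if "x \<in> vars n" for x
    proof (cases "x \<in># t")
      case True
      then show ?thesis using i by simp
    next
      case False
      then have "x \<in># s" using that un by blast
      then show ?thesis using i eq by simp
    qed
    then show "\<exists>i\<in>Var t. \<exists>j\<in>Var s. P i = P j \<and> (\<forall>x\<in>vars n. P i \<le> P x)"
      unfolding Var_def using i j eq by metis
  next
    assume "\<exists>i\<in>Var t. \<exists>j\<in>Var s. P i = P j \<and> (\<forall>x\<in>vars n. P i \<le> P x)"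
    then obtain i j where "i \<in># t" "j \<in># s" and eq: "P i = P j" and "\<forall>x\<in>vars n. P i \<le> P x"
      by (auto simp: Var_def)
    then have mem: "P i \<in> P ` set_mset t" "P i \<in> P ` set_mset s"
      and le: "\<And>x. x \<in> set_mset t \<union> set_mset s \<Longrightarrow> P i \<le> P x"
      using imageI[of i "set_mset t" P] imageI[of j "set_mset s" P] un by simp_all
    have "Min (P ` set_mset t) = P i" "Min (P ` set_mset s) = P i"
      using le by (intro Min_eqI mem; fastforce)+
    then show "Min (P ` set_mset t) = Min (P ` set_mset s)" by simp
  qed
  finally show ?thesis .
qed

section \<open>Refining level sets\<close>

text \<open>The rank is strictly increasing, hence injective on \<open>F\<close>, and stays below
  \<open>card F\<close> because \<open>u\<close> itself is not counted. Equal cardinalities then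
  give equality. This numbers the values of a point without gaps.\<close>

lemma rank_image:
  fixes F :: "'a::linorder set"
  assumes "finite F"
  shows "(\<lambda>u. card {v \<in> F. v < u}) ` F = {..<card F}"
proof (rule card_subset_eq)
  have less: "card {v \<in> F. v < a} < card {v \<in> F. v < b}" if "a \<in> F" "a < b" for a b
    using assms that by (intro psubset_card_mono) auto
  have "inj_on (\<lambda>u. card {v \<in> F. v < u}) F"
    by (rule linorder_inj_onI') (use less in fastforce)
  then show "card ((\<lambda>u. card {v \<in> F. v < u}) ` F) = card {..<card F}"
    by (simp add: card_image)
  show "(\<lambda>u. card {v \<in> F. v < u}) ` F \<subseteq> {..<card F}"
    using assms by (auto intro!: psubset_card_mono)
qed simp

text \<open>
  Grading the elements by \<open>r\<close> encodes an ordered partition into \<open>l\<close> nonempty classes. The last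
  conjunct says both that \<open>f\<close> is constant on classes and that it is monotone across them.
\<close>

lemma monotone_grading_exists:
  fixes f :: "'a \<Rightarrow> 'b::linorder"
  assumes "finite A" "i \<in> A" "j \<in> A" "f i = f j" "\<And>x. x \<in> A \<Longrightarrow> f i \<le> f x"
    and "card (f ` A) \<le> l" "l < card A"
  shows "\<exists>r::'a \<Rightarrow> nat. r ` A = {..<l} \<and> r i = 0 \<and> r j = 0 \<and>
    (\<forall>x\<in>A. \<forall>y\<in>A. r x \<le> r y \<longrightarrow> f x \<le> f y)"
  using assms(6,7)
\<comment> \<open>The induction starts with the level sets of \<open>f\<close> as classes; each step
  creates one more class.\<close>
proof (induction l rule: dec_induct)
  case base
  define r where "r x = card {v \<in> f ` A. v < f x}" for x
  have "r ` A = {..<card (f ` A)}"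
    using rank_image[of "f ` A"] assms(1) by (simp add: r_def image_image)
  moreover have "r i = 0"
  proof -
    have "{v \<in> f ` A. v < f i} = {}" using assms(5) by (auto dest: leD)
    then show ?thesis unfolding r_def by (metis card.empty)
  qed
  moreover have "r j = 0"
    using \<open>r i = 0\<close> assms(4) by (simp add: r_def)
  moreover have "f x \<le> f y" if "x \<in> A" "y \<in> A" "r x \<le> r y" for x y
  proof (rule ccontr)
    assume "\<not> f x \<le> f y"
    \<comment> \<open>The value \<open>f y\<close> itself is counted in \<open>r x\<close> but not
      in \<open>r y\<close>.\<close>
    then have "{v \<in> f ` A. v < f y} \<subseteq> {v \<in> f ` A. v < f x}"
      and "f y \<in> {v \<in> f ` A. v < f x} - {v \<in> f ` A. v < f y}"
      using \<open>y \<in> A\<close> by (auto simp: not_le)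
    then have "{v \<in> f ` A. v < f y} \<subset> {v \<in> f ` A. v < f x}" by blast
    then have "r y < r x"
      unfolding r_def using assms(1) by (intro psubset_card_mono) simp
    then show False using that by simp
  qed
  ultimately show ?case by blast
next
  case (step l)
  then obtain r where r: "r ` A = {..<l}" "r i = 0" "r j = 0"
    and mono: "\<And>x y. x \<in> A \<Longrightarrow> y \<in> A \<Longrightarrow> r x \<le> r y \<Longrightarrow> f x \<le> f y"
    by force
  have "r ` (A - {j}) \<subseteq> {..<l}" using r(1) by blast
  then have "card (r ` (A - {j})) \<le> l"
    using card_mono[of "{..<l}"] by simp
  \<comment> \<open>From \<open>Suc l < card A\<close>, more than \<open>l\<close> elements remain
    without \<open>j\<close>, while \<open>r\<close> has only \<open>l\<close> values.\<close>
  also have "l < card (A - {j})" using step.prems assms(1,3) by simp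
  finally have "\<not> inj_on r (A - {j})" by (rule pigeonhole)
  \<comment> \<open>At most one of the two colliding elements is \<open>i\<close>; the names are
    chosen so that \<open>y\<close> is not.\<close>
  then obtain x y where xy: "x \<in> A" "y \<in> A" "x \<noteq> y" "r x = r y" "y \<noteq> i" "y \<noteq> j"
    unfolding inj_on_def by (metis DiffE insertCI)
  \<comment> \<open>\<open>y\<close> becomes a class of its own directly after its old class, which
    keeps \<open>x\<close>; all later classes move up by one.\<close>
  define r' where "r' z = (if r y < r z \<or> z = y then Suc (r z) else r z)" for z
  have "r' ` A = {..<Suc l}"
  proof
    have "r z < l" if "z \<in> A" for z using that r(1) by blast
    then show "r' ` A \<subseteq> {..<Suc l}" by (auto simp: r'_def less_SucI)
    show "{..<Suc l} \<subseteq> r' ` A"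
    proof
      fix k assume k: "k \<in> {..<Suc l}"
      have preim: "\<exists>z\<in>A. r z = m" if "m < l" for m
        using that r(1) by (metis imageE lessThan_iff)
      have "r y < l" using r(1) xy(2) by blast
      consider "k < r y" | "k = r y" | "k = Suc (r y)" | "Suc (r y) < k" by linarith
      then show "k \<in> r' ` A"
      proof cases
        case 1
        then obtain z where "z \<in> A" "r z = k" using preim[of k] \<open>r y < l\<close> by auto
        then show ?thesis using 1 by (intro image_eqI[of _ _ z]) (auto simp: r'_def)
      next
        case 2
        then show ?thesis using xy by (intro image_eqI[of _ _ x]) (auto simp: r'_def)
      next
        case 3
        then show ?thesis using xy by (intro image_eqI[of _ _ y]) (auto simp: r'_def)
      next
        case 4
        then have "k - 1 < l" using k by auto
        then obtain z where "z \<in> A" "r z = k - 1" using preim by blast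
        then show ?thesis using 4 by (intro image_eqI[of _ _ z]) (auto simp: r'_def)
      qed
    qed
  qed
  moreover have "r' i = 0" "r' j = 0" using r xy by (auto simp: r'_def)
  \<comment> \<open>The new order refines the old one, so \<open>mono\<close> carries over.\<close>
  moreover have "r a \<le> r b" if "r' a \<le> r' b" for a b
    using that by (auto simp: r'_def split: if_splits)
  ultimately show ?case using mono by blast
qed

section \<open>Ordered partitions as monotonicity conditions\<close>

text \<open>The case \<open>k < m\<close> gives the inequalities of the system; the case
  \<open>k = m\<close>, read in both directions, gives its equalities.\<close>

lemma Y_part_iff:
  assumes "ordered_partition l n \<sigma>"
  shows "P \<in> Y_part l n \<sigma> \<longleftrightarrow> P \<in> points l n \<and>
    (\<forall>k<l. \<forall>m<l. \<forall>x\<in>\<sigma> ! k. \<forall>y\<in>\<sigma> ! m. k \<le> m \<longrightarrow> P x \<le> P y)"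
proof (cases "P \<in> points l n")
  case True
  have len: "length \<sigma> = l" using assms by (simp add: ordered_partition_def)
  \<comment> \<open>This bound removes the starting value \<open>l\<close> of the fold from the
    evaluations below.\<close>
  have le: "P x \<le> l" if "k < l" "x \<in> \<sigma> ! k" for k x
    using points_le[OF True] assms that by (auto simp: ordered_partition_def)
  have eq: "solves l P ({#x#}, {#y#}) \<longleftrightarrow> P x = P y"
    if "k < l" "m < l" "x \<in> \<sigma> ! k" "y \<in> \<sigma> ! m" for k m x y
    using le[OF that(1,3)] le[OF that(2,4)]
    by (simp add: solves_def eval_term_eq_Min_insert min_absorb2)
  have less: "solves l P (le_eqn {#x#} {#y#}) \<longleftrightarrow> P x \<le> P y"
    if "k < l" "m < l" "x \<in> \<sigma> ! k" "y \<in> \<sigma> ! m" for k m x y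
    using le[OF that(1,3)] le[OF that(2,4)]
    by (auto simp: solves_def le_eqn_def eval_term_eq_Min_insert min_def)
  have "P \<in> Y_part l n \<sigma> \<longleftrightarrow>
      (\<forall>x y. part_eq \<sigma> x y \<longrightarrow> solves l P ({#x#}, {#y#})) \<and>
      (\<forall>x y. part_less \<sigma> x y \<longrightarrow> solves l P (le_eqn {#x#} {#y#}))"
    using True by (auto simp: Y_part_def V_def S_part_def)
  also have "\<dots> \<longleftrightarrow>
      (\<forall>k<l. \<forall>m<l. \<forall>x\<in>\<sigma> ! k. \<forall>y\<in>\<sigma> ! m. k \<le> m \<longrightarrow> P x \<le> P y)"
    (is "?L \<longleftrightarrow> ?R")
  proof
    assume L: ?L
    show ?R
    proof (intro allI impI ballI)
      fix k m x y
      assume *: "k < l" "m < l" "x \<in> \<sigma> ! k" "y \<in> \<sigma> ! m" "k \<le> m"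
      show "P x \<le> P y"
      proof (cases "k = m")
        case True
        then have "part_eq \<sigma> x y" using * len by (auto simp: part_eq_def)
        then show ?thesis using L eq[OF *(1-4)] by simp
      next
        case False
        then have "k < m" using *(5) by simp
        then have "part_less \<sigma> x y" using * len unfolding part_less_def by blast
        then show ?thesis using L less[OF *(1-4)] by simp
      qed
    qed
  next
    assume R: ?R
    have "solves l P ({#x#}, {#y#})" if xy: "part_eq \<sigma> x y" for x y
    proof -
      obtain k where k: "k < l" "x \<in> \<sigma> ! k" "y \<in> \<sigma> ! k"
        using xy len by (auto simp: part_eq_def)
      then have "P x = P y" using R by (simp add: order_antisym)
      then show ?thesis using eq k by blast
    qed
    moreover have "solves l P (le_eqn {#x#} {#y#})" if xy: "part_less \<sigma> x y" for x y
    proof -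
      obtain k m where km: "k < m" "m < l" "x \<in> \<sigma> ! k" "y \<in> \<sigma> ! m"
        using xy len by (auto simp: part_less_def)
      then have "k < l" "k \<le> m" by simp_all
      then show ?thesis using R less km by blast
    qed
    ultimately show ?L by blast
  qed
  finally show ?thesis using True by simp
qed (simp add: Y_part_def V_def)

theorem lemma4p2:
  fixes l n :: nat and t s :: sterm and Y :: "(nat \<Rightarrow> nat) set"
  assumes "l \<ge> 1" and "n > l"
    and "(t, s) \<in> Eq n"
    and "Y = V l n {(t, s)}"
  shows "Y = (\<Union>\<sigma>\<in>{\<sigma>. ordered_partition l n \<sigma> \<and> irreducible_for (t, s) \<sigma>}. Y_part l n \<sigma>)"
proof (intro set_eqI iffI)
  fix P assume "P \<in> Y"
  then have P: "P \<in> points l n" and "solves l P (t, s)"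
    using assms(4) by (auto simp: V_def)
  then obtain i j where ij: "i \<in> Var t" "j \<in> Var s" "P i = P j" "\<And>x. x \<in> vars n \<Longrightarrow> P i \<le> P x"
    using solves_Eq_iff[OF assms(3) P] by blast
  have ijv: "i \<in> vars n" "j \<in> vars n"
    using ij assms(3) by (auto simp: Eq_def terms_def Var_def)
  \<comment> \<open>There are at most \<open>l\<close> level sets because the chain has
    \<open>l\<close> elements; \<open>n > l\<close> leaves room to refine them to exactly
    \<open>l\<close> classes.\<close>
  have "P ` vars n \<subseteq> chain l" using P by (auto simp: points_def)
  then have "card (P ` vars n) \<le> l"
    using card_mono[of "chain l"] by (simp add: chain_def)
  moreover have "finite (vars n)" "card (vars n) = n" by (simp_all add: vars_def)
  ultimately obtain r :: "nat \<Rightarrow> nat" where r: "r ` vars n = {..<l}" "r i = 0" "r j = 0"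
    and mono: "\<And>x y. x \<in> vars n \<Longrightarrow> y \<in> vars n \<Longrightarrow> r x \<le> r y \<Longrightarrow> P x \<le> P y"
    using monotone_grading_exists[of "vars n" i j P l] ij ijv assms(2) by auto
  \<comment> \<open>The classes are the fibres of \<open>r\<close>, listed by increasing
    rank.\<close>
  define \<sigma> where "\<sigma> = map (\<lambda>k. {x \<in> vars n. r x = k}) [0..<l]"
  have nth: "\<sigma> ! k = {x \<in> vars n. r x = k}" if "k < l" for k
    using that by (simp add: \<sigma>_def)
  have "\<sigma> ! k \<noteq> {}" if "k < l" for k
  proof -
    have "k \<in> r ` vars n" using that r(1) by simp
    then show ?thesis using nth[OF that] by blast
  qed
  moreover have "disjoint_family_on (\<lambda>k. \<sigma> ! k) {..<l}"
    by (auto simp: disjoint_family_on_def nth)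
  moreover have "(\<Union>k<l. \<sigma> ! k) = vars n"
    using r(1) by (auto simp: nth)
  ultimately have part: "ordered_partition l n \<sigma>"
    by (simp add: ordered_partition_def \<sigma>_def)
  \<comment> \<open>The first class exists as \<open>l \<ge> 1\<close>, and it contains
    \<open>i\<close> and \<open>j\<close>, both of rank 0.\<close>
  moreover have "irreducible_for (t, s) \<sigma>"
    using nth[of 0] assms(1) ij ijv r by (auto simp: irreducible_for_def)
  moreover have "P \<in> Y_part l n \<sigma>"
    using P mono by (auto simp: Y_part_iff[OF part] nth)
  ultimately show
    "P \<in> (\<Union>\<sigma>\<in>{\<sigma>. ordered_partition l n \<sigma> \<and> irreducible_for (t, s) \<sigma>}. Y_part l n \<sigma>)"
    by blast
next
  fix P assume
    "P \<in> (\<Union>\<sigma>\<in>{\<sigma>. ordered_partition l n \<sigma> \<and> irreducible_for (t, s) \<sigma>}. Y_part l n \<sigma>)"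
  then obtain \<sigma> where \<sigma>: "ordered_partition l n \<sigma>" "irreducible_for (t, s) \<sigma>" "P \<in> Y_part l n \<sigma>"
    by blast
  have P: "P \<in> points l n"
    and mono: "\<And>k m x y. k < l \<Longrightarrow> m < l \<Longrightarrow> x \<in> \<sigma> ! k \<Longrightarrow> y \<in> \<sigma> ! m \<Longrightarrow> k \<le> m \<Longrightarrow> P x \<le> P y"
    using \<sigma>(3) unfolding Y_part_iff[OF \<sigma>(1)] by blast+
  obtain i j where ij: "i \<in> \<sigma> ! 0" "i \<in> Var t" "j \<in> \<sigma> ! 0" "j \<in> Var s"
    using \<sigma>(2) by (auto simp: irreducible_for_def)
  \<comment> \<open>Within the first class monotonicity holds in both directions; against any later
    class it makes \<open>P i\<close> the overall minimum.\<close>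
  have "P i = P j" using mono[of 0 0] ij assms(1) by (simp add: order_antisym)
  moreover have "P i \<le> P x" if x: "x \<in> vars n" for x
  proof -
    obtain k where "k < l" "x \<in> \<sigma> ! k"
      using \<sigma>(1) x unfolding ordered_partition_def by blast
    then show ?thesis using mono[of 0 k] ij assms(1) by simp
  qed
  ultimately have "solves l P (t, s)"
    using ij solves_Eq_iff[OF assms(3) P] by blast
  then show "P \<in> Y" using P assms(4) by (simp add: V_def)
qed

end
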